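(* Let $\mathbb{K}$ be a field of characteristic $\neq 2$, let $V$ be an $n$-dimensional vector space over $\mathbb{K}$, and let $\omega$ be a nonzero skew-symmetric bilinear form on $V$. Let $\mathcal{L}_\omega(\mathbb{K})$ be the affine variety of all $\omega$-Lie algebras on $V$ with respect to $\omega$, and let $G_\omega$ be the stabilizer of $\omega$ in $\mathrm{GL}(V)$. Then there exists a one-to-one correspondence between the set of isomorphism classes (of $\omega$-Lie algebras) of $\mathcal{L}_\omega(\mathbb{K})$ and the orbit space of $\mathcal{L}_\omega(\mathbb{K})$ under the action of $G_\omega$ given by $(g\cdot[-,-])(x,y):=g\big[g^{-1}(x),g^{-1}(y)\big]$ for $g\in G_\omega$, $[-,-]\in\mathcal{L}_\omega(\mathbb{K})$, $x,y\in V$.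
   Context: An $\omega$-Lie algebra over $\mathbb{K}$ is a triple $(L,[-,-],\omega)$ where $L$ is a finite-dimensional vector space over $\mathbb{K}$, $[-,-]:L\times L\to L$ is a skew-symmetric bilinear product, and $\omega:L\times L\to\mathbb{K}$ is a bilinear form such that $[[x,y],z]+[[y,z],x]+[[z,x],y]=\omega(x,y)z+\omega(y,z)x+\omega(z,x)y$ for all $x,y,z\in L$. For a fixed $V$ and $\omega$, $\mathcal{L}_\omega(\mathbb{K})$ denotes the set of all skew-symmetric brackets $[-,-]$ on $V$ such that $(V,[-,-],\omega)$ is an $\omega$-Lie algebra (viewed as an affine variety via structure constants with respect to a basis of $V$). Two $\omega$-Lie algebras $(L_1,[-,-]_1,\omega_1)$ and $(L_2,[-,-]_2,\omega_2)$ are isomorphic if there is an algebra isomorphism (a linear bijection preserving brackets) $g:L_1\to L_2$ with $\omega_1(x,y)=\omega_2(g(x),g(y))$ for all $x,y\in L_1$. The stabilizer of $\omega$ is $G_\omega:=\{g\in \mathrm{GL}(V)\mid \omega(g(v),g(w))=\omega(v,w)\text{ for all }v,w\in V\}$. *)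

theory Defs
  imports Complex_Main "HOL-Algebra.Group_Action"
begin

definition bilinear_map ::
  "('k::field \<Rightarrow> 'u::ab_group_add \<Rightarrow> 'u) \<Rightarrow> ('k \<Rightarrow> 'v::ab_group_add \<Rightarrow> 'v) \<Rightarrow>
   ('k \<Rightarrow> 'w::ab_group_add \<Rightarrow> 'w) \<Rightarrow> ('u \<Rightarrow> 'v \<Rightarrow> 'w) \<Rightarrow> bool"
  where "bilinear_map s1 s2 s3 b \<longleftrightarrow>
    (\<forall>x. Vector_Spaces.linear s2 s3 (b x)) \<and> (\<forall>y. Vector_Spaces.linear s1 s3 (\<lambda>x. b x y))"

definition skew_symmetric :: "('v \<Rightarrow> 'v \<Rightarrow> 'w::ab_group_add) \<Rightarrow> bool"
  where "skew_symmetric b \<longleftrightarrow> (\<forall>x y. b x y = - b y x)"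

text \<open>The underlying vector space is the whole type \<open>'v\<close>, with scalar multiplication \<open>scale\<close>.
  The form \<open>\<omega>\<close> is only required to be bilinear here.\<close>

locale omega_lie_algebra = vector_space scale
  for scale :: "'k::field \<Rightarrow> 'v::ab_group_add \<Rightarrow> 'v" +
  fixes bracket :: "'v \<Rightarrow> 'v \<Rightarrow> 'v" and \<omega> :: "'v \<Rightarrow> 'v \<Rightarrow> 'k"
  assumes finite_dim: "\<exists>B. finite_dimensional_vector_space scale B"
    and bracket_bilinear: "bilinear_map scale scale scale bracket"
    and bracket_skew: "skew_symmetric bracket"
    and form_bilinear: "bilinear_map scale scale (*) \<omega>"
    and omega_jacobi:
      "bracket (bracket x y) z + bracket (bracket y z) x + bracket (bracket z x) y =
       scale (\<omega> x y) z + scale (\<omega> y z) x + scale (\<omega> z x) y"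

text \<open>The set of points of the affine variety (a bracket is determined by its structure constants
  in any fixed basis); no Zariski-topological structure is recorded.\<close>

definition omega_lie_variety ::
  "('k::field \<Rightarrow> 'v::ab_group_add \<Rightarrow> 'v) \<Rightarrow> ('v \<Rightarrow> 'v \<Rightarrow> 'k) \<Rightarrow> ('v \<Rightarrow> 'v \<Rightarrow> 'v) set"
  where "omega_lie_variety scale \<omega> = {b. omega_lie_algebra scale b \<omega>}"

definition omega_lie_isomorphic ::
  "('k::field \<Rightarrow> 'v::ab_group_add \<Rightarrow> 'v) \<Rightarrow> ('v \<Rightarrow> 'v \<Rightarrow> 'v) \<Rightarrow> ('v \<Rightarrow> 'v \<Rightarrow> 'k) \<Rightarrow>
   ('k \<Rightarrow> 'w::ab_group_add \<Rightarrow> 'w) \<Rightarrow> ('w \<Rightarrow> 'w \<Rightarrow> 'w) \<Rightarrow> ('w \<Rightarrow> 'w \<Rightarrow> 'k) \<Rightarrow> bool"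
  where "omega_lie_isomorphic s1 b1 \<omega>1 s2 b2 \<omega>2 \<longleftrightarrow>
    (\<exists>g. Vector_Spaces.linear s1 s2 g \<and> bij g \<and>
         (\<forall>x y. g (b1 x y) = b2 (g x) (g y)) \<and>
         (\<forall>x y. \<omega>1 x y = \<omega>2 (g x) (g y)))"

definition iso_rel ::
  "('k::field \<Rightarrow> 'v::ab_group_add \<Rightarrow> 'v) \<Rightarrow> ('v \<Rightarrow> 'v \<Rightarrow> 'k) \<Rightarrow>
   (('v \<Rightarrow> 'v \<Rightarrow> 'v) \<times> ('v \<Rightarrow> 'v \<Rightarrow> 'v)) set"
  where "iso_rel scale \<omega> = {(b, b'). b \<in> omega_lie_variety scale \<omega> \<and>
    b' \<in> omega_lie_variety scale \<omega> \<and> omega_lie_isomorphic scale b \<omega> scale b' \<omega>}"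

definition iso_classes ::
  "('k::field \<Rightarrow> 'v::ab_group_add \<Rightarrow> 'v) \<Rightarrow> ('v \<Rightarrow> 'v \<Rightarrow> 'k) \<Rightarrow> ('v \<Rightarrow> 'v \<Rightarrow> 'v) set set"
  where "iso_classes scale \<omega> = omega_lie_variety scale \<omega> // iso_rel scale \<omega>"

definition general_linear ::
  "('k::field \<Rightarrow> 'v::ab_group_add \<Rightarrow> 'v) \<Rightarrow> ('v \<Rightarrow> 'v) monoid"
  where "general_linear scale =
    \<lparr>carrier = {g. Vector_Spaces.linear scale scale g \<and> bij g}, mult = (\<circ>), one = id\<rparr>"

definition form_stabilizer ::
  "('k::field \<Rightarrow> 'v::ab_group_add \<Rightarrow> 'v) \<Rightarrow> ('v \<Rightarrow> 'v \<Rightarrow> 'k) \<Rightarrow> ('v \<Rightarrow> 'v) monoid"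
  where "form_stabilizer scale \<omega> = (general_linear scale)
    \<lparr>carrier := {g \<in> carrier (general_linear scale). \<forall>v w. \<omega> (g v) (g w) = \<omega> v w}\<rparr>"

text \<open>\<open>inv_into UNIV g\<close> is the inverse function of \<open>g\<close>; the restriction to the variety is what
  \<^const>\<open>BijGroup\<close>, and hence \<^const>\<open>group_action\<close>, asks for.\<close>

definition bracket_action ::
  "('k::field \<Rightarrow> 'v::ab_group_add \<Rightarrow> 'v) \<Rightarrow> ('v \<Rightarrow> 'v \<Rightarrow> 'k) \<Rightarrow>
   ('v \<Rightarrow> 'v) \<Rightarrow> ('v \<Rightarrow> 'v \<Rightarrow> 'v) \<Rightarrow> ('v \<Rightarrow> 'v \<Rightarrow> 'v)"
  where "bracket_action scale \<omega> g = (\<lambda>b \<in> omega_lie_variety scale \<omega>.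
    \<lambda>x y. g (b (inv_into UNIV g x) (inv_into UNIV g y)))"

lemma linear_inv_into:
  assumes "Vector_Spaces.linear s1 s2 g" "bij g"
  shows "Vector_Spaces.linear s2 s1 (inv_into UNIV g)"
proof -
  interpret Vector_Spaces.linear s1 s2 g by fact
  have gi: "g (inv_into UNIV g x) = x" for x
    using assms(2) by (simp add: bij_is_surj surj_f_inv_f)
  have inj: "u = v" if "g u = g v" for u v
    using that assms(2) by (simp add: bij_is_inj inj_eq)
  show ?thesis
    by (intro Vector_Spaces.linear.intro module_hom.intro module_hom_axioms.intro
        vs1.vector_space_axioms vs2.vector_space_axioms vs1.module_axioms vs2.module_axioms inj)
      (simp_all add: gi add scale)
qed

lemma group_general_linear:
  assumes "vector_space scale"
  shows "group (general_linear scale)"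
proof (rule groupI)
  interpret vector_space scale by fact
  show "\<one>\<^bsub>general_linear scale\<^esub> \<in> carrier (general_linear scale)"
    by (simp add: general_linear_def linear_id)
  fix x assume x: "x \<in> carrier (general_linear scale)"
  then show "\<exists>y\<in>carrier (general_linear scale).
      y \<otimes>\<^bsub>general_linear scale\<^esub> x = \<one>\<^bsub>general_linear scale\<^esub>"
    by (intro bexI[of _ "inv_into UNIV x"])
      (auto simp: general_linear_def linear_inv_into bij_imp_bij_inv bij_is_inj)
qed (auto simp: general_linear_def o_assoc intro: Vector_Spaces.linear_compose bij_comp)

lemma subgroup_form_stabilizer:
  assumes "vector_space scale"
  shows "subgroup (carrier (form_stabilizer scale \<omega>)) (general_linear scale)"
proof -
  interpret vector_space scale by fact
  interpret G: group "general_linear scale" by (rule group_general_linear) fact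
  have inv: "m_inv (general_linear scale) g = inv_into UNIV g"
    if "g \<in> carrier (general_linear scale)" for g
    using that by (intro G.inv_equality)
      (auto simp: general_linear_def linear_inv_into bij_imp_bij_inv bij_is_inj)
  have form: "\<omega> (inv_into UNIV g v) (inv_into UNIV g w) = \<omega> v w"
    if "bij g" "\<forall>v w. \<omega> (g v) (g w) = \<omega> v w" for g v w
    using that by (metis bij_inv_eq_iff)
  show ?thesis
  proof (rule subgroup.intro)
    fix g assume g: "g \<in> carrier (form_stabilizer scale \<omega>)"
    then have "m_inv (general_linear scale) g = inv_into UNIV g"
      by (intro inv) (simp add: form_stabilizer_def)
    then show "m_inv (general_linear scale) g \<in> carrier (form_stabilizer scale \<omega>)"
      using g by (simp add: form_stabilizer_def general_linear_def form linear_inv_into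
          bij_imp_bij_inv)
  qed (auto simp: form_stabilizer_def general_linear_def linear_id
      intro: Vector_Spaces.linear_compose bij_comp)
qed

lemma group_form_stabilizer:
  assumes "vector_space scale"
  shows "group (form_stabilizer scale \<omega>)"
  using group.subgroup_imp_group[OF group_general_linear subgroup_form_stabilizer, OF assms assms]
  by (simp add: form_stabilizer_def)

lemma omega_lie_transport:
  assumes b: "omega_lie_algebra scale b \<omega>"
    and g: "Vector_Spaces.linear scale scale g" "bij g" "\<forall>v w. \<omega> (g v) (g w) = \<omega> v w"
  shows "omega_lie_algebra scale (\<lambda>x y. g (b (inv_into UNIV g x) (inv_into UNIV g y))) \<omega>"
proof -
  interpret omega_lie_algebra scale b \<omega> by fact
  interpret g: Vector_Spaces.linear scale scale g by fact
  let ?h = "inv_into UNIV g"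
  have h: "Vector_Spaces.linear scale scale ?h"
    using g(1,2) by (rule linear_inv_into)
  have gh: "g (?h x) = x" and hg: "?h (g x) = x" for x
    using g(2) by (simp_all add: bij_is_surj surj_f_inv_f bij_is_inj)
  have form: "\<omega> x y = \<omega> (?h x) (?h y)" for x y
    using g(3) gh by metis
  show ?thesis
  proof
    show "\<exists>B. finite_dimensional_vector_space scale B" by (fact finite_dim)
    show "bilinear_map scale scale (*) \<omega>" by (fact form_bilinear)
    have r: "Vector_Spaces.linear scale scale (b u)"
      and l: "Vector_Spaces.linear scale scale (\<lambda>v. b v u)" for u
      using bracket_bilinear by (simp_all add: bilinear_map_def)
    have "Vector_Spaces.linear scale scale (g \<circ> (b u \<circ> ?h))"
      and "Vector_Spaces.linear scale scale (g \<circ> ((\<lambda>v. b v u) \<circ> ?h))" for u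
      by (intro Vector_Spaces.linear_compose[OF Vector_Spaces.linear_compose[OF h r] g(1)]
          Vector_Spaces.linear_compose[OF Vector_Spaces.linear_compose[OF h l] g(1)])+
    then show "bilinear_map scale scale scale (\<lambda>x y. g (b (?h x) (?h y)))"
      by (simp add: bilinear_map_def o_def)
    show "skew_symmetric (\<lambda>x y. g (b (?h x) (?h y)))"
      using bracket_skew unfolding skew_symmetric_def by (metis g.neg)
    fix x y z
    have "g (b (b (?h x) (?h y)) (?h z) + b (b (?h y) (?h z)) (?h x) + b (b (?h z) (?h x)) (?h y)) =
      g (scale (\<omega> x y) (?h z) + scale (\<omega> y z) (?h x) + scale (\<omega> z x) (?h y))"
      unfolding omega_jacobi by (simp only: form[of x y] form[of y z] form[of z x])
    then show "g (b (?h (g (b (?h x) (?h y)))) (?h z)) + g (b (?h (g (b (?h y) (?h z)))) (?h x)) +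
        g (b (?h (g (b (?h z) (?h x)))) (?h y)) =
      scale (\<omega> x y) z + scale (\<omega> y z) x + scale (\<omega> z x) y"
      by (simp add: hg gh g.add g.scale)
  qed
qed

lemma group_action_bracket_action:
  assumes "vector_space scale"
  shows "group_action (form_stabilizer scale \<omega>) (omega_lie_variety scale \<omega>)
    (bracket_action scale \<omega>)"
proof -
  let ?L = "omega_lie_variety scale \<omega>" and ?G = "form_stabilizer scale \<omega>"
    and ?a = "bracket_action scale \<omega>"
  interpret G: group ?G by (rule group_form_stabilizer) fact
  have bij: "bij g" if "g \<in> carrier ?G" for g
    using that by (simp add: form_stabilizer_def general_linear_def)
  have clo: "?a g b \<in> ?L" if "g \<in> carrier ?G" "b \<in> ?L" for g b
    using that by (auto simp: bracket_action_def omega_lie_variety_def form_stabilizer_def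
        general_linear_def intro: omega_lie_transport)
  have comp: "?a (g \<otimes>\<^bsub>?G\<^esub> h) b = ?a g (?a h b)"
    if "g \<in> carrier ?G" "h \<in> carrier ?G" "b \<in> ?L" for g h b
  proof -
    have "?a (g \<otimes>\<^bsub>?G\<^esub> h) b = ?a (g \<circ> h) b"
      by (simp add: form_stabilizer_def general_linear_def)
    also have "\<dots> = ?a g (?a h b)"
      using that(3) clo[OF that(2,3)] bij[OF that(1)] bij[OF that(2)]
      by (simp add: bracket_action_def o_inv_distrib)
    finally show ?thesis .
  qed
  have one: "?a \<one>\<^bsub>?G\<^esub> b = b" if "b \<in> ?L" for b
    using that by (simp add: bracket_action_def form_stabilizer_def general_linear_def inv_id)
  have Bij: "?a g \<in> Bij ?L" if g: "g \<in> carrier ?G" for g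
  proof -
    have "?a (inv\<^bsub>?G\<^esub> g) (?a g b) = b" "?a g (?a (inv\<^bsub>?G\<^esub> g) b) = b" if "b \<in> ?L" for b
      using g that by (simp_all add: comp[symmetric] one)
    then have "bij_betw (?a g) ?L ?L"
      using g clo by (intro bij_betw_byWitness[where f' = "?a (inv\<^bsub>?G\<^esub> g)"]) auto
    then show ?thesis by (simp add: Bij_def bracket_action_def)
  qed
  show ?thesis
  proof (intro group_action.intro group_hom.intro group_hom_axioms.intro homI group_BijGroup
      G.group_axioms)
    fix g h assume gh: "g \<in> carrier ?G" "h \<in> carrier ?G"
    have "?a (g \<otimes>\<^bsub>?G\<^esub> h) = compose ?L (?a g) (?a h)"
    proof
      fix b show "?a (g \<otimes>\<^bsub>?G\<^esub> h) b = compose ?L (?a g) (?a h) b"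
        using comp[OF gh] by (cases "b \<in> ?L") (auto simp: compose_def bracket_action_def)
    qed
    then show "?a (g \<otimes>\<^bsub>?G\<^esub> h) = ?a g \<otimes>\<^bsub>BijGroup ?L\<^esub> ?a h"
      using gh by (simp add: BijGroup_def Bij)
  qed (simp add: BijGroup_def Bij)
qed

lemma equiv_iso_rel: "equiv (omega_lie_variety scale \<omega>) (iso_rel scale \<omega>)"
proof (rule equivI)
  show "refl_on (omega_lie_variety scale \<omega>) (iso_rel scale \<omega>)"
  proof (rule refl_onI)
    fix b assume b: "b \<in> omega_lie_variety scale \<omega>"
    then interpret omega_lie_algebra scale b \<omega> by (simp add: omega_lie_variety_def)
    show "(b, b) \<in> iso_rel scale \<omega>"
      using b by (auto simp: iso_rel_def omega_lie_isomorphic_def intro!: exI[of _ id] linear_id)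
  qed
  show "sym (iso_rel scale \<omega>)"
  proof (rule symI)
    fix b c assume bc: "(b, c) \<in> iso_rel scale \<omega>"
    then obtain g where g: "Vector_Spaces.linear scale scale g" "bij g"
      "\<forall>x y. g (b x y) = c (g x) (g y)" "\<forall>x y. \<omega> x y = \<omega> (g x) (g y)"
      by (auto simp: iso_rel_def omega_lie_isomorphic_def)
    have "inv_into UNIV g (c x y) = b (inv_into UNIV g x) (inv_into UNIV g y)"
      "\<omega> x y = \<omega> (inv_into UNIV g x) (inv_into UNIV g y)" for x y
      using g(2-4) by (metis bij_inv_eq_iff)+
    then show "(c, b) \<in> iso_rel scale \<omega>"
      using bc linear_inv_into[OF g(1,2)] bij_imp_bij_inv[OF g(2)]
      by (auto simp: iso_rel_def omega_lie_isomorphic_def)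
  qed
  show "trans (iso_rel scale \<omega>)"
  proof (rule transI)
    fix b c d assume bc: "(b, c) \<in> iso_rel scale \<omega>" and cd: "(c, d) \<in> iso_rel scale \<omega>"
    obtain g where g: "Vector_Spaces.linear scale scale g" "bij g"
      "\<forall>x y. g (b x y) = c (g x) (g y)" "\<forall>x y. \<omega> x y = \<omega> (g x) (g y)"
      using bc by (auto simp: iso_rel_def omega_lie_isomorphic_def)
    obtain h where h: "Vector_Spaces.linear scale scale h" "bij h"
      "\<forall>x y. h (c x y) = d (h x) (h y)" "\<forall>x y. \<omega> x y = \<omega> (h x) (h y)"
      using cd by (auto simp: iso_rel_def omega_lie_isomorphic_def)
    have "omega_lie_isomorphic scale b \<omega> scale d \<omega>"
      unfolding omega_lie_isomorphic_def using g h
      by (intro exI[of _ "h \<circ> g"]) (auto intro: Vector_Spaces.linear_compose bij_comp)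
    then show "(b, d) \<in> iso_rel scale \<omega>"
      using bc cd by (simp add: iso_rel_def)
  qed
qed (auto simp: iso_rel_def)

end

theory Submission
  imports Defs
begin

text \<open>Both sides classify brackets on the same vector space with the same form, and both do so by
  the same maps.  An isomorphism from \<open>b\<close> to \<open>c\<close> is a linear bijection \<open>g\<close> that preserves \<open>\<omega>\<close>, that
  is, an element of the stabilizer, subject to \<open>g (b x y) = c (g x) (g y)\<close>.  Replacing \<open>x\<close> and \<open>y\<close>
  by their preimages under \<open>g\<close> turns this equation into \<open>c x y = g (b (g\<inverse> x) (g\<inverse> y))\<close>, which says that
  \<open>c\<close> is the translate of \<open>b\<close> by \<open>g\<close>.  So the isomorphism class of a bracket and its orbit are the
  same set (lemma \<open>iso_class_eq_orbit\<close>), and the identity is the required correspondence.\<close>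

lemma intertwines_iff_conjugate:
  assumes "bij g"
  shows "(\<forall>x y. g (b x y) = c (g x) (g y)) \<longleftrightarrow>
    c = (\<lambda>x y. g (b (inv_into UNIV g x) (inv_into UNIV g y)))"
  using assms by (auto simp: fun_eq_iff bij_is_inj bij_is_surj surj_f_inv_f)

text \<open>A translate of \<open>b\<close> has to lie in the variety again before it can count as isomorphic to \<open>b\<close>;
  this is where \<open>omega_lie_transport\<close> enters.\<close>

lemma iso_class_eq_orbit:
  assumes b: "b \<in> omega_lie_variety scale \<omega>"
  shows "iso_rel scale \<omega> `` {b} = orbit (form_stabilizer scale \<omega>) (bracket_action scale \<omega>) b"
proof (intro Set.set_eqI iffI)
  fix c assume "c \<in> iso_rel scale \<omega> `` {b}"
  then obtain g where g: "Vector_Spaces.linear scale scale g" "bij g"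
      "\<forall>x y. g (b x y) = c (g x) (g y)" "\<forall>x y. \<omega> x y = \<omega> (g x) (g y)"
    by (auto simp: iso_rel_def omega_lie_isomorphic_def)
  have "g \<in> carrier (form_stabilizer scale \<omega>)"
    using g by (simp add: form_stabilizer_def general_linear_def)
  moreover have "bracket_action scale \<omega> g b = c"
    using g(3) b by (simp add: bracket_action_def intertwines_iff_conjugate[OF g(2)])
  ultimately show "c \<in> orbit (form_stabilizer scale \<omega>) (bracket_action scale \<omega>) b"
    by (auto simp: orbit_def)
next
  fix c assume "c \<in> orbit (form_stabilizer scale \<omega>) (bracket_action scale \<omega>) b"
  then obtain g where g: "Vector_Spaces.linear scale scale g" "bij g"
      "\<forall>v w. \<omega> (g v) (g w) = \<omega> v w"
    and c: "c = bracket_action scale \<omega> g b"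
    by (auto simp: orbit_def form_stabilizer_def general_linear_def)
  have conj: "c = (\<lambda>x y. g (b (inv_into UNIV g x) (inv_into UNIV g y)))"
    using b c by (simp add: bracket_action_def)
  then have "c \<in> omega_lie_variety scale \<omega>"
    using omega_lie_transport[OF _ g] b by (simp add: omega_lie_variety_def)
  moreover have "\<forall>x y. g (b x y) = c (g x) (g y)"
    using conj by (rule iffD2[OF intertwines_iff_conjugate[OF g(2)]])
  ultimately show "c \<in> iso_rel scale \<omega> `` {b}"
    using b g by (auto simp: iso_rel_def omega_lie_isomorphic_def)
qed

theorem theorem1p1:
  fixes scale :: "'k::field \<Rightarrow> 'v::ab_group_add \<Rightarrow> 'v"
    and \<omega> :: "'v \<Rightarrow> 'v \<Rightarrow> 'k"
    and Basis :: "'v set"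
    and n :: nat
  assumes "CHAR('k) \<noteq> 2"
    and "finite_dimensional_vector_space scale Basis"
    and "vector_space.dim scale (UNIV :: 'v set) = n"
    and "bilinear_map scale scale (*) \<omega>"
    and "skew_symmetric \<omega>"
    and "\<exists>x y. \<omega> x y \<noteq> 0"
  shows "\<exists>f. bij_betw f (iso_classes scale \<omega>)
      (orbits (form_stabilizer scale \<omega>) (omega_lie_variety scale \<omega>) (bracket_action scale \<omega>)) \<and>
    (\<forall>b \<in> omega_lie_variety scale \<omega>.
      f (iso_rel scale \<omega> `` {b}) = orbit (form_stabilizer scale \<omega>) (bracket_action scale \<omega>) b)"
proof (intro exI conjI ballI)
  have "iso_classes scale \<omega> =
      orbits (form_stabilizer scale \<omega>) (omega_lie_variety scale \<omega>) (bracket_action scale \<omega>)"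
    by (auto simp: iso_classes_def quotient_def orbits_def iso_class_eq_orbit)
  then show "bij_betw id (iso_classes scale \<omega>)
      (orbits (form_stabilizer scale \<omega>) (omega_lie_variety scale \<omega>) (bracket_action scale \<omega>))"
    by simp
  show "id (iso_rel scale \<omega> `` {b}) = orbit (form_stabilizer scale \<omega>) (bracket_action scale \<omega>) b"
    if "b \<in> omega_lie_variety scale \<omega>" for b
    using that by (simp add: iso_class_eq_orbit)
qed

end
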